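(* For every integer $m\ge 2$, $$\sum_{k=2}^{\infty}\frac{\zeta(k)-1}{k^m}=1-\gamma-\zeta(m)+C_m .$$
   Context: $\zeta$ is the Riemann zeta function and $\gamma$ is Euler's constant. For an integer $m\ge2$, $\operatorname{Li}_m(z)=\sum_{n=1}^{\infty} z^n/n^m$ (for $|z|\le 1$) is the polylogarithm, and $$C_m:=\lim_{n\to\infty}\left(\sum_{k=1}^n \operatorname{Li}_m\!\left(\frac1k\right)-\log n\right).$$ *)

theory Defs
  imports "HOL-Analysis.Analysis"
begin

(* The Dirichlet series represents the Riemann zeta function exactly for Re s > 1; no analytic
   continuation is built in, so the definition is only meaningful on that half-plane. *)
definition zeta :: "complex \<Rightarrow> complex" where
  "zeta s = (\<Sum>n. 1 / of_nat (Suc n) powr s)"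

(* Intended for m \<ge> 2 and norm z \<le> 1, where the series converges absolutely. *)
definition polylog :: "nat \<Rightarrow> complex \<Rightarrow> complex" where
  "polylog m z = (\<Sum>n. z ^ Suc n / of_nat (Suc n) ^ m)"

definition polylog_const_seq :: "nat \<Rightarrow> nat \<Rightarrow> complex" where
  "polylog_const_seq m n = (\<Sum>k=1..n. polylog m (1 / of_nat k)) - of_real (ln (real n))"

definition polylog_const :: "nat \<Rightarrow> complex" where
  "polylog_const m = lim (polylog_const_seq m)"

end

theory Submission imports Defs begin

text \<open>Both sides are iterated sums of the absolutely convergent double series
  \<open>\<Sum>\<^sub>j\<^sub>,\<^sub>k\<^sub>\<ge>\<^sub>2 1 / (j^k k^m)\<close>: summing over \<open>j\<close> first gives the zeta side, summing over \<open>k\<close> first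
  gives \<open>\<Sum>\<^sub>j (Li\<^sub>m(1/j) - 1/j)\<close>. The terms \<open>1/j\<close> pair with the logarithm to
  produce Euler's constant.\<close>

text \<open>Fubini for absolutely summable families. Unordered sums over the product do not depend
  on the order of the indices, and \<open>has_sum_imp_sums\<close> turns them into ordinary
  series.\<close>

lemma sums_suminf_swap:
  fixes f :: "nat \<Rightarrow> nat \<Rightarrow> 'a :: banach"
  assumes "(\<lambda>(i, j). norm (f i j)) summable_on UNIV \<times> UNIV"
  obtains S where "(\<lambda>i. \<Sum>j. f i j) sums S" "(\<lambda>j. \<Sum>i. f i j) sums S"
proof -
  \<comment> \<open>Kept general in \<open>h\<close> because it is applied both to \<open>f\<close>
    and to its transpose, with the same total \<open>S\<close>.\<close>
  have iterated: "(\<lambda>i. \<Sum>j. h i j) sums S"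
    if abs: "(\<lambda>(i, j). norm (h i j)) summable_on UNIV \<times> UNIV"
      and h: "((\<lambda>(i, j). h i j) has_sum S) (UNIV \<times> UNIV)"
    for h :: "nat \<Rightarrow> nat \<Rightarrow> 'a" and S
  proof -
    have row: "(h i has_sum (\<Sum>j. h i j)) UNIV" for i
    proof -
      have "(\<lambda>j. norm (h i j)) summable_on UNIV"
        using summable_on_SigmaD1[OF abs, of i] by simp
      then have "h i summable_on UNIV"
        by (rule abs_summable_summable)
      then show ?thesis
        using has_sum_infsum has_sum_imp_sums sums_unique by metis
    qed
    have "((\<lambda>i. \<Sum>j. h i j) has_sum S) UNIV"
      by (rule has_sum_SigmaD[OF h]) (use row in auto)
    then show ?thesis
      by (rule has_sum_imp_sums)
  qed
  have "(\<lambda>(i, j). f i j) summable_on UNIV \<times> UNIV"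
    by (rule abs_summable_summable) (use assms in \<open>simp add: case_prod_unfold\<close>)
  then obtain S where S: "((\<lambda>(i, j). f i j) has_sum S) (UNIV \<times> UNIV)"
    using summable_on_def by blast
  then have "((\<lambda>(j, i). f i j) has_sum S) (UNIV \<times> UNIV)"
    by (subst (asm) has_sum_swap) simp
  moreover have "(\<lambda>(j, i). norm (f i j)) summable_on UNIV \<times> UNIV"
    using assms unfolding summable_on_def by (subst (asm) has_sum_swap) simp
  ultimately show ?thesis
    using S assms by (intro that iterated)
qed

text \<open>The norm is multiplicative, so for fixed \<open>x\<close> the inner sum is
  \<open>norm (f x)\<close> times a constant.\<close>

lemma summable_on_Times_norm_mult:
  fixes f :: "'a \<Rightarrow> 'c :: real_normed_div_algebra" and g :: "'b \<Rightarrow> 'c"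
  assumes "(\<lambda>x. norm (f x)) summable_on A" "(\<lambda>y. norm (g y)) summable_on B"
  shows "(\<lambda>(x, y). norm (f x * g y)) summable_on A \<times> B"
proof (rule summable_on_SigmaI)
  show "((\<lambda>y. case (x, y) of (x, y) \<Rightarrow> norm (f x * g y))
      has_sum norm (f x) * (\<Sum>\<^sub>\<infinity>y\<in>B. norm (g y))) B" for x
    unfolding norm_mult prod.case using assms(2) by (intro has_sum_cmult_right has_sum_infsum)
  show "(\<lambda>x. norm (f x) * (\<Sum>\<^sub>\<infinity>y\<in>B. norm (g y))) summable_on A"
    using assms(1) by (rule summable_on_cmult_left)
qed auto

text \<open>The bases are at least 1 and both exponents, \<open>j + 2\<close> and \<open>m\<close>,
  are at least 2. Hence each term is dominated by \<open>1 / ((i + 2)^2 * (j + 2)^2)\<close>, a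
  product of two summable families.\<close>

lemma inverse_powers_norm_summable:
  assumes "2 \<le> m"
  shows "(\<lambda>(i, j). norm (1 / (of_nat (i + 2) ^ (j + 2) * of_nat (j + 2) ^ m) :: complex))
    summable_on UNIV \<times> UNIV"
proof (rule summable_on_comparison_test)
  let ?g = "\<lambda>n::nat. 1 / of_nat (n + 2) ^ 2 :: complex"
  have "summable (\<lambda>n. norm (?g n))"
    using summable_ignore_initial_segment[OF inverse_power_summable[of 2, where 'a = real], of 2]
    by (simp add: norm_divide norm_power inverse_eq_divide
        del: of_nat_add of_nat_Suc add_2_eq_Suc')
  then have "(\<lambda>n. norm (?g n)) summable_on UNIV"
    by (subst summable_on_UNIV_nonneg_real_iff) auto
  then show "(\<lambda>(i, j). norm (?g i * ?g j)) summable_on UNIV \<times> UNIV"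
    by (intro summable_on_Times_norm_mult)
  have "norm (1 / (of_nat (i + 2) ^ (j + 2) * of_nat (j + 2) ^ m) :: complex)
      \<le> norm (?g i * ?g j)" for i j
  proof -
    have "real (i + 2) ^ 2 * real (j + 2) ^ 2 \<le> real (i + 2) ^ (j + 2) * real (j + 2) ^ m"
      using assms by (intro mult_mono power_increasing) auto
    then show ?thesis
      by (simp add: norm_divide norm_mult norm_power frac_le
          del: of_nat_add of_nat_Suc add_2_eq_Suc' power_Suc power_add)
  qed
  then show "(case p of (i, j) \<Rightarrow>
        norm (1 / (of_nat (i + 2) ^ (j + 2) * of_nat (j + 2) ^ m) :: complex))
      \<le> (case p of (i, j) \<Rightarrow> norm (?g i * ?g j))" for p
    by (cases p) simp
qed auto

lemma summable_inverse_Suc_power: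
  assumes "2 \<le> m"
  shows "summable (\<lambda>n. 1 / of_nat (Suc n) ^ m :: complex)"
  using inverse_power_summable[OF assms, where 'a = complex]
  by (subst (asm) summable_Suc_iff[symmetric]) (simp add: inverse_eq_divide)

lemma zeta_of_nat: "zeta (of_nat m) = (\<Sum>n. 1 / of_nat (Suc n) ^ m)"
  unfolding zeta_def by (simp add: powr_nat' del: of_nat_Suc)

lemma zeta_of_nat_minus_1:
  assumes "2 \<le> m"
  shows "zeta (of_nat m) - 1 = (\<Sum>n. 1 / of_nat (n + 2) ^ m)"
  using suminf_split_head[OF summable_inverse_Suc_power[OF assms]]
  by (simp add: zeta_of_nat)

lemma polylog_1: "polylog m 1 = zeta (of_nat m)"
  by (simp add: polylog_def zeta_of_nat)

text \<open>The leading term of the series is \<open>z\<close> itself. Splitting it off needs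
  convergence, which holds by comparison with the series of \<open>1 / (n + 1)^m\<close>.\<close>

lemma polylog_minus_self:
  assumes "2 \<le> m" "norm z \<le> 1"
  shows "polylog m z - z = (\<Sum>n. z ^ (n + 2) / of_nat (n + 2) ^ m)"
proof -
  have "summable (\<lambda>n. z ^ Suc n / of_nat (Suc n) ^ m)"
  proof (rule summable_comparison_test)
    show "summable (\<lambda>n. 1 / real (Suc n) ^ m)"
      using inverse_power_summable[OF assms(1), where 'a = real]
      by (subst (asm) summable_Suc_iff[symmetric]) (simp add: inverse_eq_divide)
    have "norm z ^ Suc n \<le> 1" for n
      using assms(2) by (intro power_le_one) auto
    then show "\<exists>N. \<forall>n\<ge>N. norm (z ^ Suc n / of_nat (Suc n) ^ m) \<le> 1 / real (Suc n) ^ m"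
      by (auto simp: norm_divide norm_power simp del: of_nat_Suc power_Suc intro!: divide_right_mono)
  qed
  from suminf_split_head[OF this] show ?thesis
    by (simp add: polylog_def)
qed

text \<open>The term \<open>k = 1\<close> is \<open>zeta m\<close>, written as
  \<open>(zeta m - 1) + 1\<close>. That 1 and the terms \<open>1 / (j + 2)\<close> subtracted from
  the polylogarithms make up \<open>harm (Suc n)\<close>.\<close>

lemma polylog_const_seq_Suc:
  "polylog_const_seq m (Suc n) = zeta (of_nat m) - 1
     + (\<Sum>j<n. polylog m (1 / of_nat (j + 2)) - 1 / of_nat (j + 2))
     + (harm (Suc n) - of_real (ln (of_nat (Suc n))))"
proof -
  have head: "(\<Sum>k=1..Suc n. h k) = h 1 + (\<Sum>j<n. h (j + 2))" for h :: "nat \<Rightarrow> complex"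
    by (induction n) auto
  show ?thesis
    unfolding polylog_const_seq_def harm_def head
    by (simp add: polylog_1 sum_subtractf inverse_eq_divide
        del: of_nat_add add_2_eq_Suc')
qed

theorem mainTheorem1:
  fixes m :: nat
  assumes "m \<ge> 2"
  shows "convergent (polylog_const_seq m) \<and>
    (\<lambda>k. (zeta (of_nat (k + 2)) - 1) / of_nat (k + 2) ^ m) sums
      (1 - euler_mascheroni - zeta (of_nat m) + polylog_const m)"
proof -
  let ?f = "\<lambda>i j::nat. 1 / (of_nat (i + 2) ^ (j + 2) * of_nat (j + 2) ^ m) :: complex"
  obtain S where polylog_side: "(\<lambda>i. \<Sum>j. ?f i j) sums S"
    and zeta_side: "(\<lambda>j. \<Sum>i. ?f i j) sums S"
    using sums_suminf_swap[OF inverse_powers_norm_summable[OF assms]] by blast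
  \<comment> \<open>Here \<open>z = 1 / (i + 2)\<close>, whose norm is at most 1.\<close>
  have "(\<Sum>j. ?f i j) = polylog m (1 / of_nat (i + 2)) - 1 / of_nat (i + 2)" for i
    by (subst polylog_minus_self)
      (use assms in \<open>auto simp: norm_divide power_divide field_simps
        simp del: of_nat_add of_nat_Suc add_2_eq_Suc' power_Suc\<close>)
  then have "(\<lambda>n. \<Sum>i<n. polylog m (1 / of_nat (i + 2)) - 1 / of_nat (i + 2)) \<longlonglongrightarrow> S"
    using polylog_side by (simp add: sums_def)
  moreover have "(\<lambda>n. harm (Suc n) - of_real (ln (of_nat (Suc n))) :: complex)
      \<longlonglongrightarrow> euler_mascheroni"
    using LIMSEQ_Suc[OF euler_mascheroni_LIMSEQ_of_real[where 'a = complex]]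
    by (simp add: of_real_harm del: of_nat_Suc)
  ultimately have "(\<lambda>n. polylog_const_seq m (Suc n))
      \<longlonglongrightarrow> zeta (of_nat m) - 1 + S + euler_mascheroni"
    unfolding polylog_const_seq_Suc by (intro tendsto_intros)
  \<comment> \<open>The decomposition covers only indices \<open>Suc n\<close>, since it splits off
    \<open>k = 1\<close>; the shift does not affect the limit.\<close>
  then have lim: "polylog_const_seq m \<longlonglongrightarrow> zeta (of_nat m) - 1 + S + euler_mascheroni"
    by (rule LIMSEQ_imp_Suc)
  \<comment> \<open>By uniqueness of limits this limit is \<open>polylog_const m\<close>, and the
    equation is solved for \<open>S\<close>.\<close>
  then have "S = 1 - euler_mascheroni - zeta (of_nat m) + polylog_const m"
    by (simp add: polylog_const_def limI)
  moreover have "(\<Sum>i. ?f i j) = (zeta (of_nat (j + 2)) - 1) / of_nat (j + 2) ^ m" for j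
  proof -
    \<comment> \<open>Convergence lets the factor \<open>1 / (j + 2)^m\<close>, constant in
      \<open>i\<close>, be pulled out of the sum.\<close>
    have "summable (\<lambda>i. 1 / of_nat (i + 2) ^ (j + 2) :: complex)"
      using summable_ignore_initial_segment[OF summable_inverse_Suc_power[of "j + 2"], of 1]
      by simp
    from suminf_divide[OF this, of "of_nat (j + 2) ^ m"] show ?thesis
      by (subst zeta_of_nat_minus_1) (simp_all del: of_nat_add of_nat_Suc add_2_eq_Suc' power_Suc)
  qed
  ultimately show ?thesis
    using zeta_side lim by (auto simp: convergent_def)
qed

end
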